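(* Let $H$ be a complex Hilbert space with $\dim(H)\ge 2$. Then for every non-empty $\mathbf{G}\subseteq H$ and every non-empty $\Theta\subseteq\mathbb{T}$, the following statements are equivalent: 1. $\mathbf{G}$ does $\Theta$-PR. 2. There exists a Möbius transform $M\in\mathrm{Aut}(\mathbb{T})$ such that $\mathbf{G}$ does $M(\Theta)$-PR. 3. For every Möbius transform $M\in\mathrm{Aut}(\mathbb{T})$, $\mathbf{G}$ does $M(\Theta)$-PR.
   Context: $\mathbb{T}=\{z\in\mathbb{C}:|z|=1\}$. The inner product $\langle\cdot,\cdot\rangle$ is linear in the first and conjugate linear in the second argument. For $\Theta\subseteq\mathbb{T}$, a set $\mathbf{G}\subseteq H$ does $\Theta$-PR (in $H$) if for all $f,h\in H$ the following holds: if for every $g\in\mathbf{G}$ there exists $\theta_g\in\Theta$ with $\langle f,g\rangle=\theta_g\langle h,g\rangle$, then $f=\theta h$ for some $\theta\in\Theta$. A Möbius transform is a map $M(z)=\frac{az+b}{cz+d}$ with $a,b,c,d\in\mathbb{C}$, $ad-bc\ne0$. $\mathrm{Aut}(\mathbb{T})$ denotes the group of bijections of $\mathbb{T}$, so "$M\in\mathrm{Aut}(\mathbb{T})$ a Möbius transform" means a Möbius transform that restricts to a bijection of $\mathbb{T}$ onto itself. $M(\Theta)=\{M(\theta):\theta\in\Theta\}$. *)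

theory Defs
  imports "HOL-Analysis.Analysis" "HOL-Library.Extended_Nat"
begin

class complex_vector = real_vector +
  fixes scaleC :: "complex \<Rightarrow> 'a \<Rightarrow> 'a"  (infixr "*\<^sub>C" 75)
  assumes scaleC_add_right: "a *\<^sub>C (x + y) = a *\<^sub>C x + a *\<^sub>C y"
    and scaleC_add_left: "(a + b) *\<^sub>C x = a *\<^sub>C x + b *\<^sub>C x"
    and scaleC_scaleC: "a *\<^sub>C (b *\<^sub>C x) = (a * b) *\<^sub>C x"
    and scaleC_one: "1 *\<^sub>C x = x"
    and scaleR_scaleC: "r *\<^sub>R x = complex_of_real r *\<^sub>C x"

global_interpretation complex_vector:
  vector_space "scaleC :: complex \<Rightarrow> 'a \<Rightarrow> 'a::complex_vector"
  by unfold_locales (rule scaleC_add_right scaleC_add_left scaleC_scaleC scaleC_one)+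

(* Linear in the first and conjugate linear in the second argument. Definiteness and
   norm x = sqrt <x,x> come from the parent class real_inner through the last axiom;
   see cinner_self. *)
class complex_inner = complex_vector + real_inner +
  fixes cinner :: "'a \<Rightarrow> 'a \<Rightarrow> complex"
  assumes cinner_add_left: "cinner (x + y) z = cinner x z + cinner y z"
    and cinner_scaleC_left: "cinner (a *\<^sub>C x) y = a * cinner x y"
    and cinner_commute: "cinner x y = cnj (cinner y x)"
    and inner_eq_Re_cinner: "inner x y = Re (cinner x y)"

lemma cinner_self: "cinner x x = complex_of_real ((norm x)\<^sup>2)"
proof (rule complex_eqI)
  show "Re (cinner x x) = Re (complex_of_real ((norm x)\<^sup>2))"
    by (simp add: power2_norm_eq_inner inner_eq_Re_cinner)
  have "cinner x x = cnj (cinner x x)"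
    by (rule cinner_commute)
  then have "Im (cinner x x) = Im (cnj (cinner x x))"
    by (rule arg_cong)
  then show "Im (cinner x x) = Im (complex_of_real ((norm x)\<^sup>2))"
    by simp
qed

class complex_hilbert = complex_inner + complete_space

(* The case distinction is needed because the library's dim is 0 on
   infinite-dimensional spaces. *)
definition complex_dim :: "'a::complex_vector itself \<Rightarrow> enat" where
  "complex_dim _ =
     (if \<exists>B :: 'a set. finite B \<and> complex_vector.span B = UNIV
      then enat (complex_vector.dim (UNIV :: 'a set)) else \<infinity>)"

definition does_PR :: "complex set \<Rightarrow> 'a::complex_inner set \<Rightarrow> bool" where
  "does_PR \<Theta> G \<longleftrightarrow>
     (\<forall>f h. (\<forall>g\<in>G. \<exists>\<theta>\<in>\<Theta>. cinner f g = \<theta> * cinner h g) \<longrightarrow>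
            (\<exists>\<theta>\<in>\<Theta>. f = \<theta> *\<^sub>C h))"

abbreviation unit_circle :: "complex set" where
  "unit_circle \<equiv> sphere 0 1"

(* The Moebius transform lives on the Riemann sphere, while moebius sends a pole to 0.
   Neither 0 nor infinity lies on the unit circle, so a transform with a pole on the
   circle is excluded under both readings. *)
definition circle_moebius :: "(complex \<Rightarrow> complex) \<Rightarrow> bool" where
  "circle_moebius M \<longleftrightarrow>
     (\<exists>a b c d. a * d - b * c \<noteq> 0 \<and> M = moebius a b c d) \<and>
     bij_betw M unit_circle unit_circle"

end

theory Submission
  imports Defs
begin

text \<open>
  If \<open>\<langle>f,g\<rangle> = (a \<theta> + b) / (c \<theta> + d) * \<langle>h,g\<rangle>\<close>, then clearing the denominator gives
  \<open>\<langle>b h - d f, g\<rangle> = \<theta> * \<langle>c f - a h, g\<rangle>\<close>, where the two vectors do not depend on \<open>g\<close>.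
  So \<open>\<Theta>\<close>-PR applies to the pair \<open>b h - d f\<close>, \<open>c f - a h\<close>, and reading the
  same computation backwards yields \<open>f = (a \<theta> + b) / (c \<theta> + d) h\<close>.
  The converse passage from \<open>M(\<Theta>)\<close> to \<open>\<Theta>\<close> uses the inverse transform.
\<close>

text \<open>Asking only for a denominator that does not vanish on \<open>\<Theta>\<close> lets the
  lemma serve both a circle transform and its inverse.\<close>

lemma does_PR_moebius_image:
  fixes G :: "'a::complex_inner set"
  assumes PR: "does_PR \<Theta> G"
    and nz: "\<And>\<theta>. \<theta> \<in> \<Theta> \<Longrightarrow> c * \<theta> + d \<noteq> 0"
  shows "does_PR (moebius a b c d ` \<Theta>) G"
  unfolding does_PR_def
proof (intro allI impI)
  fix f h :: 'a
  assume H: "\<forall>g\<in>G. \<exists>w\<in>moebius a b c d ` \<Theta>. cinner f g = w * cinner h g"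
  have pointwise: "\<exists>\<theta>\<in>\<Theta>. cinner (b *\<^sub>C h + (- d) *\<^sub>C f) g = \<theta> * cinner (c *\<^sub>C f + (- a) *\<^sub>C h) g"
    if "g \<in> G" for g
  proof -
    obtain \<theta> where \<theta>: "\<theta> \<in> \<Theta>" "cinner f g = moebius a b c d \<theta> * cinner h g"
      using bspec[OF H \<open>g \<in> G\<close>] by blast
    then have "(c * \<theta> + d) * cinner f g = (a * \<theta> + b) * cinner h g"
      using nz[OF \<theta>(1)] by (simp add: moebius_def)
    \<comment> \<open>The scalars sit in the first, linear argument, so no conjugates
      appear.\<close>
    moreover have "cinner (b *\<^sub>C h + (- d) *\<^sub>C f) g - \<theta> * cinner (c *\<^sub>C f + (- a) *\<^sub>C h) g
        = (a * \<theta> + b) * cinner h g - (c * \<theta> + d) * cinner f g"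
      by (simp only: cinner_add_left cinner_scaleC_left) (simp add: algebra_simps)
    ultimately show ?thesis
      using \<theta>(1) by (metis eq_iff_diff_eq_0)
  qed
  have "\<exists>\<theta>\<in>\<Theta>. b *\<^sub>C h + (- d) *\<^sub>C f = \<theta> *\<^sub>C (c *\<^sub>C f + (- a) *\<^sub>C h)"
    by (rule PR[unfolded does_PR_def, rule_format]) (rule pointwise)
  then obtain \<theta> where \<theta>: "\<theta> \<in> \<Theta>"
    and eq: "b *\<^sub>C h + (- d) *\<^sub>C f = \<theta> *\<^sub>C (c *\<^sub>C f + (- a) *\<^sub>C h)"
    by blast
  have "(c * \<theta> + d) *\<^sub>C f - (a * \<theta> + b) *\<^sub>C h
      = \<theta> *\<^sub>C (c *\<^sub>C f + (- a) *\<^sub>C h) - (b *\<^sub>C h + (- d) *\<^sub>C f)"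
    by (simp add: scaleC_add_left scaleC_scaleC complex_vector.scale_right_diff_distrib mult.commute)
  then have *: "(c * \<theta> + d) *\<^sub>C f = (a * \<theta> + b) *\<^sub>C h"
    using eq by simp
  have "f = (inverse (c * \<theta> + d) * (c * \<theta> + d)) *\<^sub>C f"
    using nz[OF \<theta>] by (simp add: scaleC_one)
  also have "\<dots> = inverse (c * \<theta> + d) *\<^sub>C ((a * \<theta> + b) *\<^sub>C h)"
    by (simp only: scaleC_scaleC[symmetric] *)
  also have "\<dots> = moebius a b c d \<theta> *\<^sub>C h"
    by (simp only: scaleC_scaleC moebius_def divide_inverse mult.commute)
  finally have "f = moebius a b c d \<theta> *\<^sub>C h" .
  then show "\<exists>w\<in>moebius a b c d ` \<Theta>. f = w *\<^sub>C h"
    using \<theta> by blast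
qed

lemma does_PR_circle_moebius_image_iff:
  fixes G :: "'a::complex_inner set"
  assumes "circle_moebius M" and sub: "\<Theta> \<subseteq> unit_circle"
  shows "does_PR (M ` \<Theta>) G \<longleftrightarrow> does_PR \<Theta> G"
proof -
  obtain a b c d where det: "a * d - b * c \<noteq> 0" and M: "M = moebius a b c d"
    and bij: "bij_betw M unit_circle unit_circle"
    using assms(1) unfolding circle_moebius_def by blast
  \<comment> \<open>A zero denominator would give the junk value \<open>M \<theta> = 0\<close>, which is not on the circle.\<close>
  have nz: "c * \<theta> + d \<noteq> 0" if "\<theta> \<in> \<Theta>" for \<theta>
  proof
    assume "c * \<theta> + d = 0"
    then have "M \<theta> = 0"
      by (simp add: M moebius_def)
    moreover have "M \<theta> \<in> unit_circle"
      using bij_betwE[OF bij] that sub by blast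
    ultimately show False
      by simp
  qed
  \<comment> \<open>The adjugate matrix of the coefficients gives the inverse transform.\<close>
  have inv: "moebius d (- b) (- c) a ` M ` \<Theta> = \<Theta>"
    using nz det by (force simp: image_image M moebius_inverse)
  \<comment> \<open>At \<open>w = M \<theta>\<close>, the denominator of the inverse times that of
    \<open>M\<close> at \<open>\<theta>\<close> is the determinant.\<close>
  have nz': "- c * w + a \<noteq> 0" if "w \<in> M ` \<Theta>" for w
  proof -
    obtain \<theta> where \<theta>: "\<theta> \<in> \<Theta>" "w = M \<theta>"
      using \<open>w \<in> M ` \<Theta>\<close> by blast
    then have "w * (c * \<theta> + d) = a * \<theta> + b"
      using nz by (simp add: M moebius_def)
    moreover have "(- c * w + a) * (c * \<theta> + d) = a * (c * \<theta> + d) - c * (w * (c * \<theta> + d))"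
      by (simp add: ring_distribs)
    ultimately have "(- c * w + a) * (c * \<theta> + d) = a * d - b * c"
      by (simp add: ring_distribs)
    then show ?thesis
      using det by auto
  qed
  show ?thesis
  proof
    assume "does_PR (M ` \<Theta>) G"
    then have "does_PR (moebius d (- b) (- c) a ` M ` \<Theta>) G"
      using nz' by (rule does_PR_moebius_image)
    then show "does_PR \<Theta> G"
      unfolding inv .
  next
    assume "does_PR \<Theta> G"
    then show "does_PR (M ` \<Theta>) G"
      unfolding M using nz by (rule does_PR_moebius_image)
  qed
qed

text \<open>Provides the witness for the existential statement and the instance at which the
  universal one returns \<open>\<Theta>\<close> itself.\<close>

lemma circle_moebius_id: "circle_moebius (\<lambda>z. z)"
proof -
  have "(\<lambda>z. z) = moebius 1 0 0 (1 :: complex)"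
    by (auto simp: moebius_def)
  moreover have "(1 :: complex) * 1 - 0 * 0 \<noteq> 0"
    by simp
  moreover have "bij_betw (\<lambda>z. z) unit_circle unit_circle"
    by (simp add: bij_betw_def)
  ultimately show ?thesis
    unfolding circle_moebius_def by blast
qed

theorem theorem1p7:
  fixes G :: "'a::complex_hilbert set"
    and \<Theta> :: "complex set"
  assumes "complex_dim TYPE('a) \<ge> 2"
    and "G \<noteq> {}"
    and "\<Theta> \<noteq> {}"
    and "\<Theta> \<subseteq> unit_circle"
  shows "(does_PR \<Theta> G \<longleftrightarrow> (\<exists>M. circle_moebius M \<and> does_PR (M ` \<Theta>) G)) \<and>
         (does_PR \<Theta> G \<longleftrightarrow> (\<forall>M. circle_moebius M \<longrightarrow> does_PR (M ` \<Theta>) G))"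
  using does_PR_circle_moebius_image_iff[OF _ assms(4)] circle_moebius_id by metis

end
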